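(* Let $E$ be an acyclic directed graph and $K$ a field. If $L_K(E)$ is locally Lie solvable, then $L_K(E)$ is Lie solvable.
   Context: A directed graph $E=(E^0,E^1,r,s)$ consists of sets $E^0$ (vertices), $E^1$ (edges), of arbitrary cardinality, and maps $r,s:E^1\to E^0$ (range, source). A vertex is regular if it emits at least one and only finitely many edges; $\mathrm{Reg}(E)$ is the set of regular vertices. $E$ is acyclic if there is no sequence of edges $e_1\cdots e_n$, $n\ge1$, with $r(e_i)=s(e_{i+1})$ for $1\le i<n$ and $r(e_n)=s(e_1)$. The Leavitt path algebra $L_K(E)$ is the associative (not necessarily unital) $K$-algebra generated by $E^0\cup E^1\cup\{e^*: e\in E^1\}$ subject to: $vv'=\delta_{v,v'}v$ for $v,v'\in E^0$; $s(e)e=er(e)=e$ and $r(e)e^*=e^*s(e)=e^*$ for $e\in E^1$; $e^*f=\delta_{e,f}r(e)$ for $e,f\in E^1$; $v=\sum_{s(e)=v}ee^*$ for $v\in\mathrm{Reg}(E)$. For an associative $K$-algebra $A$, $A^-$ is the Lie algebra on $A$ with $[a,b]=ab-ba$. $A$ is Lie solvable if $A^-$ is a solvable Lie algebra (its derived series reaches $0$ after finitely many steps). $A$ is locally Lie solvable if $A^-$ is locally solvable, i.e. every finite-dimensional Lie subalgebra of $A^-$ is solvable. (For $E$ acyclic, $L_K(E)^-$ is a locally finite Lie algebra: every finite subset lies in a finite-dimensional Lie subalgebra.) *)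

theory Defs
  imports "Graph_Theory.Arc_Walk" "HOL-Library.Poly_Mapping"
begin

section \<open>Algebras given by a carrier\<close>

text \<open>
  The library's algebra structures are unital; Leavitt path algebras need not be, and neither are
  Lie algebras. The following record carries the operations of an arbitrary \<open>K\<close>-algebra
  (\<open>K\<close> being the field type \<open>'k\<close>); it serves both for associative algebras, where
  \<open>alg_mult\<close> is the multiplication, and for Lie algebras, where \<open>alg_mult\<close> is the bracket.
\<close>
record ('k, 'a) alg =
  alg_carrier :: "'a set"
  alg_zero :: 'a
  alg_add :: "'a \<Rightarrow> 'a \<Rightarrow> 'a"
  alg_smult :: "'k \<Rightarrow> 'a \<Rightarrow> 'a"
  alg_mult :: "'a \<Rightarrow> 'a \<Rightarrow> 'a"

definition alg_subspace :: "('k, 'a) alg \<Rightarrow> 'a set \<Rightarrow> bool" where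
  "alg_subspace A S \<longleftrightarrow>
     S \<subseteq> alg_carrier A \<and> alg_zero A \<in> S \<and>
     (\<forall>x\<in>S. \<forall>y\<in>S. alg_add A x y \<in> S) \<and>
     (\<forall>c. \<forall>x\<in>S. alg_smult A c x \<in> S)"

definition alg_span :: "('k, 'a) alg \<Rightarrow> 'a set \<Rightarrow> 'a set" where
  "alg_span A X = \<Inter>{S. alg_subspace A S \<and> X \<subseteq> S}"

definition alg_subalgebra :: "('k, 'a) alg \<Rightarrow> 'a set \<Rightarrow> bool" where
  "alg_subalgebra A S \<longleftrightarrow> alg_subspace A S \<and> (\<forall>x\<in>S. \<forall>y\<in>S. alg_mult A x y \<in> S)"

definition alg_finite_dim :: "('k, 'a) alg \<Rightarrow> 'a set \<Rightarrow> bool" where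
  "alg_finite_dim A S \<longleftrightarrow> (\<exists>B. finite B \<and> B \<subseteq> S \<and> alg_span A B = S)"

definition alg_ideal :: "('k, 'a) alg \<Rightarrow> 'a set \<Rightarrow> bool" where
  "alg_ideal A I \<longleftrightarrow>
     alg_subspace A I \<and>
     (\<forall>a\<in>alg_carrier A. \<forall>x\<in>I. alg_mult A a x \<in> I \<and> alg_mult A x a \<in> I)"

definition alg_ideal_gen :: "('k, 'a) alg \<Rightarrow> 'a set \<Rightarrow> 'a set" where
  "alg_ideal_gen A R = \<Inter>{I. alg_ideal A I \<and> R \<subseteq> I}"

definition alg_coset :: "('k, 'a) alg \<Rightarrow> 'a set \<Rightarrow> 'a \<Rightarrow> 'a set" where
  "alg_coset A I a = alg_add A a ` I"

text \<open>
  In the operations of the quotient algebra the cosets in each union all coincide when \<open>I\<close> is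
  an ideal, so that, for example, the product of the cosets of \<open>x\<close> and \<open>y\<close> is the coset of
  the product of \<open>x\<close> and \<open>y\<close>.
\<close>

definition alg_quotient :: "('k, 'a) alg \<Rightarrow> 'a set \<Rightarrow> ('k, 'a set) alg" where
  "alg_quotient A I =
     \<lparr>alg_carrier = alg_coset A I ` alg_carrier A,
      alg_zero = alg_coset A I (alg_zero A),
      alg_add = (\<lambda>X Y. \<Union>x\<in>X. \<Union>y\<in>Y. alg_coset A I (alg_add A x y)),
      alg_smult = (\<lambda>c X. \<Union>x\<in>X. alg_coset A I (alg_smult A c x)),
      alg_mult = (\<lambda>X Y. \<Union>x\<in>X. \<Union>y\<in>Y. alg_coset A I (alg_mult A x y))\<rparr>"


section \<open>Solvability of Lie algebras\<close>

fun derived_series :: "('k, 'a) alg \<Rightarrow> nat \<Rightarrow> 'a set" where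
  "derived_series L 0 = alg_carrier L"
| "derived_series L (Suc n) =
     alg_span L {alg_mult L x y | x y. x \<in> derived_series L n \<and> y \<in> derived_series L n}"

definition solvable_lie :: "('k, 'a) alg \<Rightarrow> bool" where
  "solvable_lie L \<longleftrightarrow> (\<exists>n. derived_series L n = {alg_zero L})"

definition locally_solvable_lie :: "('k, 'a) alg \<Rightarrow> bool" where
  "locally_solvable_lie L \<longleftrightarrow>
     (\<forall>S. alg_subalgebra L S \<and> alg_finite_dim L S \<longrightarrow> solvable_lie (L\<lparr>alg_carrier := S\<rparr>))"

text \<open>The Lie algebra \<open>A\<^sup>-\<close>, with bracket \<open>[a, b] = ab - ba\<close>.\<close>

definition lie_of :: "('k::ring_1, 'a) alg \<Rightarrow> ('k, 'a) alg" where
  "lie_of A =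
     A\<lparr>alg_mult := (\<lambda>a b. alg_add A (alg_mult A a b) (alg_smult A (- 1) (alg_mult A b a)))\<rparr>"

definition lie_solvable :: "('k::ring_1, 'a) alg \<Rightarrow> bool" where
  "lie_solvable A \<longleftrightarrow> solvable_lie (lie_of A)"

definition locally_lie_solvable :: "('k::ring_1, 'a) alg \<Rightarrow> bool" where
  "locally_lie_solvable A \<longleftrightarrow> locally_solvable_lie (lie_of A)"


section \<open>Free associative algebras\<close>

datatype 'g free_monoid = Word (letters: "'g list")

instantiation free_monoid :: (type) monoid_add
begin

definition zero_free_monoid :: "'a free_monoid" where
  "0 = Word []"

definition plus_free_monoid :: "'a free_monoid \<Rightarrow> 'a free_monoid \<Rightarrow> 'a free_monoid" where
  "u + v = Word (letters u @ letters v)"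

instance
  by standard (simp_all add: zero_free_monoid_def plus_free_monoid_def)

end

text \<open>
  Since the monoid of words is written additively, the multiplication of finitely supported
  functions on words is the multiplication of noncommutative polynomials.
\<close>

type_synonym ('g, 'k) ncpoly = "'g free_monoid \<Rightarrow>\<^sub>0 'k"

definition ncvar :: "'g \<Rightarrow> ('g, 'k::field) ncpoly" where
  "ncvar x = Poly_Mapping.single (Word [x]) 1"

text \<open>
  The free non-unital associative algebra on \<open>X\<close>: noncommutative polynomials in the variables
  \<open>X\<close> without constant term.
\<close>

definition free_alg :: "'g set \<Rightarrow> ('k::field, ('g, 'k) ncpoly) alg" where
  "free_alg X =
     \<lparr>alg_carrier = {f. \<forall>w\<in>Poly_Mapping.keys f. letters w \<noteq> [] \<and> set (letters w) \<subseteq> X},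
      alg_zero = 0,
      alg_add = (+),
      alg_smult = (\<lambda>c f. Poly_Mapping.single 0 c * f),
      alg_mult = (*)\<rparr>"


section \<open>Leavitt path algebras\<close>

text \<open>
  A directed graph is a \<open>wf_digraph\<close>, with source map \<open>tail\<close> and range map \<open>head\<close>;
  its sets of vertices and arcs may be empty or infinite.
\<close>

definition acyclic_digraph :: "('v, 'e) pre_digraph \<Rightarrow> bool" where
  "acyclic_digraph G \<longleftrightarrow> \<not> (\<exists>u p. p \<noteq> [] \<and> pre_digraph.awalk G u p u)"

definition regular_verts :: "('v, 'e) pre_digraph \<Rightarrow> 'v set" where
  "regular_verts G = {v \<in> verts G. out_arcs G v \<noteq> {} \<and> finite (out_arcs G v)}"

datatype ('v, 'e) lpa_gen = Vertex 'v | Edge 'e | Ghost 'e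

definition lpa_gens :: "('v, 'e) pre_digraph \<Rightarrow> ('v, 'e) lpa_gen set" where
  "lpa_gens G = Vertex ` verts G \<union> Edge ` arcs G \<union> Ghost ` arcs G"

text \<open>A relation \<open>l = r\<close> is represented by \<open>l - r\<close>.\<close>

definition lpa_rels :: "('v, 'e) pre_digraph \<Rightarrow> (('v, 'e) lpa_gen, 'k::field) ncpoly set" where
  "lpa_rels G =
     {ncvar (Vertex v) * ncvar (Vertex w) - (if v = w then ncvar (Vertex v) else 0)
        | v w. v \<in> verts G \<and> w \<in> verts G} \<union>
     {ncvar (Vertex (tail G e)) * ncvar (Edge e) - ncvar (Edge e) | e. e \<in> arcs G} \<union>
     {ncvar (Edge e) * ncvar (Vertex (head G e)) - ncvar (Edge e) | e. e \<in> arcs G} \<union>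
     {ncvar (Vertex (head G e)) * ncvar (Ghost e) - ncvar (Ghost e) | e. e \<in> arcs G} \<union>
     {ncvar (Ghost e) * ncvar (Vertex (tail G e)) - ncvar (Ghost e) | e. e \<in> arcs G} \<union>
     {ncvar (Ghost e) * ncvar (Edge f) - (if e = f then ncvar (Vertex (head G e)) else 0)
        | e f. e \<in> arcs G \<and> f \<in> arcs G} \<union>
     {ncvar (Vertex v) - (\<Sum>e\<in>out_arcs G v. ncvar (Edge e) * ncvar (Ghost e))
        | v. v \<in> regular_verts G}"

type_synonym ('v, 'e, 'k) lpa = "('k, (('v, 'e) lpa_gen, 'k) ncpoly set) alg"

definition leavitt_path_algebra :: "('v, 'e) pre_digraph \<Rightarrow> ('v, 'e, 'k::field) lpa" where
  "leavitt_path_algebra G =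
     alg_quotient (free_alg (lpa_gens G)) (alg_ideal_gen (free_alg (lpa_gens G)) (lpa_rels G))"

end

theory Submission
  imports Defs
begin

text \<open>
  For distinct paths \<open>p\<^sub>1, \<dots>, p\<^sub>n\<close> with the same range in an acyclic graph, the elements
  \<open>p\<^sub>i p\<^sub>j\<^sup>*\<close> are matrix units, and they are nonzero because no vertex vanishes in \<open>L\<^sub>K(E)\<close>.
  Since \<open>gl\<^sub>n\<close> is not solvable for \<open>n \<ge> 3\<close>, nor for \<open>n = 2\<close> outside characteristic 2, local
  solvability excludes paths of length 2 and pairs of arcs with the same range, and it excludes all
  arcs unless the characteristic is 2. What remains is a disjoint union of stars with arcs pointing
  away from the centre. There \<open>L\<^sub>K(E)\<close> is spanned by the elements \<open>v\<close>, \<open>e\<close>, \<open>e\<^sup>*\<close>, \<open>e e\<^sup>*\<close>; the first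
  derived algebra lies in the span of the \<open>e\<close>, the \<open>e\<^sup>*\<close> and the \<open>z\<^sub>e = e e\<^sup>* - r(e)\<close>, the second
  one in the span of the \<open>z\<^sub>e\<close>, and these commute.
\<close>

section \<open>Quotients of free algebras and their Lie algebras\<close>

abbreviation const :: "'k \<Rightarrow> ('g, 'k::field) ncpoly" where
  "const c \<equiv> Poly_Mapping.single 0 c"

text \<open>Scalars act through constant polynomials, exactly as in \<open>free_alg\<close>. This
  makes the library's subspaces and spans available for sets of polynomials.\<close>

interpretation nc: module "\<lambda>(c::'k::field) (f::('g, 'k) ncpoly). const c * f"
  by standard (simp_all add: distrib_left distrib_right single_add mult_single flip: mult.assoc)

text \<open>A polynomial is the sum of its monomials. Restricting the monomial case to words of
  \<open>f\<close> lets membership of \<open>f\<close> in a free algebra be used there.\<close>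

lemma ncpoly_induct [case_names zero single add]:
  fixes f :: "('g, 'k::field) ncpoly"
  assumes "P 0" "\<And>w c. w \<in> Poly_Mapping.keys f \<Longrightarrow> P (Poly_Mapping.single w c)"
    and "\<And>f g. P f \<Longrightarrow> P g \<Longrightarrow> P (f + g)"
  shows "P f"
proof -
  have "f = (\<Sum>w\<in>Poly_Mapping.keys f. Poly_Mapping.single w (Poly_Mapping.lookup f w))"
    by (rule poly_mapping_eqI)
      (simp add: lookup_sum lookup_single when_def in_keys_iff if_distrib sum.delta cong: if_cong)
  moreover have "P (\<Sum>w\<in>A. Poly_Mapping.single w (Poly_Mapping.lookup f w))"
    if "finite A" "A \<subseteq> Poly_Mapping.keys f" for A
    using that by (induction A rule: finite_induct) (auto intro: assms)
  ultimately show ?thesis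
    by (metis finite_keys subset_refl)
qed

lemma const_mult_commute: "f * const c = const c * (f :: ('g, 'k::field) ncpoly)"
  by (induction f rule: ncpoly_induct)
    (simp_all add: distrib_left distrib_right mult_single mult.commute)

lemma mult_const_left_commute: "f * (const c * g) = const c * (f * g :: ('g, 'k::field) ncpoly)"
  by (metis const_mult_commute mult.assoc)

lemma const_minus_one_mult: "const (- 1) * f = - (f :: ('g, 'k::field) ncpoly)"
  by (metis mult_minus1 single_one single_uminus)

definition comm :: "('g, 'k::field) ncpoly \<Rightarrow> ('g, 'k) ncpoly \<Rightarrow> ('g, 'k) ncpoly" where
  "comm f g = f * g - g * f"

text \<open>The commutator is bilinear, so the two arguments can be expanded over their generators
  one after the other.\<close>

lemma comm_span:
  assumes W: "nc.subspace W" and XY: "\<And>x y. x \<in> X \<Longrightarrow> y \<in> Y \<Longrightarrow> comm x y \<in> W"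
    and f: "f \<in> nc.span X" and g: "g \<in> nc.span Y"
  shows "comm f g \<in> W"
proof -
  have "comm x g \<in> W" if "x \<in> X" for x
    using g
  proof (induction g rule: nc.span_induct_alt)
    case base
    then show ?case using nc.subspace_0[OF W] by (simp add: comm_def)
  next
    case (step c y g)
    have "comm x (const c * y + g) = const c * comm x y + comm x g"
      by (simp add: comm_def algebra_simps mult_const_left_commute)
    then show ?case
      using step XY[OF that] by (simp add: nc.subspace_add[OF W] nc.subspace_scale[OF W])
  qed
  with f show ?thesis
  proof (induction f rule: nc.span_induct_alt)
    case base
    then show ?case using nc.subspace_0[OF W] by (simp add: comm_def)
  next
    case (step c x f)
    have "comm (const c * x + f) g = const c * comm x g + comm f g"
      by (simp add: comm_def algebra_simps mult_const_left_commute)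
    then show ?case
      using step by (simp add: nc.subspace_add[OF W] nc.subspace_scale[OF W])
  qed
qed

section \<open>Spans, subspaces and ideals in a free algebra\<close>

lemma alg_span_superset: "Y \<subseteq> alg_span A Y"
  by (auto simp: alg_span_def)

lemma alg_span_smult: "x \<in> alg_span A Y \<Longrightarrow> alg_smult A c x \<in> alg_span A Y"
  by (auto simp: alg_span_def alg_subspace_def)

lemma alg_span_minimal: "alg_subspace A T \<Longrightarrow> Y \<subseteq> T \<Longrightarrow> alg_span A Y \<subseteq> T"
  by (auto simp: alg_span_def)

lemma subspace_free_alg:
  fixes X :: "'g set"
  shows "nc.subspace (alg_carrier (free_alg X) :: ('g, 'k::field) ncpoly set)"
  unfolding nc.subspace_def
proof (intro conjI ballI allI)
  fix f g :: "('g, 'k::field) ncpoly" and c :: 'k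
  assume f: "f \<in> alg_carrier (free_alg X)"
  show "const c * f \<in> alg_carrier (free_alg X)"
    using f keys_mult[of "const c" f]
    by (fastforce simp: free_alg_def zero_free_monoid_def plus_free_monoid_def split: if_splits)
  assume "g \<in> alg_carrier (free_alg X)"
  then show "f + g \<in> alg_carrier (free_alg X)"
    using f keys_add[of f g] by (auto simp: free_alg_def)
qed (simp add: free_alg_def)

lemma mult_free_alg:
  "f \<in> alg_carrier (free_alg X) \<Longrightarrow> g \<in> alg_carrier (free_alg X) \<Longrightarrow> f * g \<in> alg_carrier (free_alg X)"
  using keys_mult[of f g] by (fastforce simp: free_alg_def plus_free_monoid_def)

lemma ncvar_free_alg: "x \<in> X \<Longrightarrow> ncvar x \<in> alg_carrier (free_alg X)"
  by (simp add: free_alg_def ncvar_def)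

lemma alg_ideal_free_alg_iff:
  "alg_ideal (free_alg X) J \<longleftrightarrow> J \<subseteq> alg_carrier (free_alg X) \<and> nc.subspace J \<and>
     (\<forall>f\<in>alg_carrier (free_alg X). \<forall>g\<in>J. f * g \<in> J \<and> g * f \<in> J)"
  by (auto simp: alg_ideal_def alg_subspace_def nc.subspace_def free_alg_def)

lemma alg_ideal_gen_superset: "R \<subseteq> alg_ideal_gen A R"
  by (auto simp: alg_ideal_gen_def)

lemma alg_ideal_gen_minimal: "alg_ideal A J \<Longrightarrow> R \<subseteq> J \<Longrightarrow> alg_ideal_gen A R \<subseteq> J"
  by (auto simp: alg_ideal_gen_def)

text \<open>An intersection of ideals is an ideal. The hypothesis puts the whole carrier into the
  intersected family, which keeps the intersection inside the carrier.\<close>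

lemma alg_ideal_gen_free_alg:
  assumes "R \<subseteq> alg_carrier (free_alg X)"
  shows "alg_ideal (free_alg X) (alg_ideal_gen (free_alg X) R)"
proof -
  have "alg_ideal (free_alg X) (alg_carrier (free_alg X))"
    by (simp add: alg_ideal_free_alg_iff subspace_free_alg mult_free_alg)
  from alg_ideal_gen_minimal[OF this assms] show ?thesis
    unfolding alg_ideal_free_alg_iff by (auto simp: alg_ideal_gen_def alg_ideal_free_alg_iff nc.subspace_def)
qed

section \<open>Congruence modulo an ideal of a free algebra\<close>

locale quotient_alg =
  fixes X :: "'g set" and I :: "('g, 'k::field) ncpoly set"
  assumes ideal: "alg_ideal (free_alg X) I"
begin

abbreviation F :: "('g, 'k) ncpoly set" where
  "F \<equiv> alg_carrier (free_alg X)"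

abbreviation L :: "('k, ('g, 'k) ncpoly set) alg" where
  "L \<equiv> alg_quotient (free_alg X) I"

abbreviation coset :: "('g, 'k) ncpoly \<Rightarrow> ('g, 'k) ncpoly set" where
  "coset \<equiv> alg_coset (free_alg X) I"

text \<open>Products are computed with polynomials up to this congruence; cosets enter only when
  passing to the quotient algebra.\<close>

definition cong :: "('g, 'k) ncpoly \<Rightarrow> ('g, 'k) ncpoly \<Rightarrow> bool" (infix "\<approx>" 50) where
  "f \<approx> g \<longleftrightarrow> f - g \<in> I"

lemma subspace_F: "nc.subspace F"
  and mult_F: "f \<in> F \<Longrightarrow> g \<in> F \<Longrightarrow> f * g \<in> F"
  by (simp_all add: subspace_free_alg mult_free_alg)

lemma subspace_I: "nc.subspace I"
  using ideal by (auto simp: alg_ideal_def alg_subspace_def nc.subspace_def free_alg_def)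

lemma I_subset_F: "I \<subseteq> F"
  using ideal by (auto simp: alg_ideal_def alg_subspace_def)

lemma mult_I_left: "f \<in> F \<Longrightarrow> g \<in> I \<Longrightarrow> f * g \<in> I"
  and mult_I_right: "f \<in> F \<Longrightarrow> g \<in> I \<Longrightarrow> g * f \<in> I"
  using ideal by (auto simp: alg_ideal_def free_alg_def)

lemma comm_I: "f \<in> F \<Longrightarrow> g \<in> I \<Longrightarrow> comm f g \<in> I" "f \<in> F \<Longrightarrow> g \<in> I \<Longrightarrow> comm g f \<in> I"
  by (simp_all add: comm_def mult_I_left mult_I_right nc.subspace_diff[OF subspace_I])

lemma cong_refl [simp]: "f \<approx> f"
  using nc.subspace_0[OF subspace_I] by (simp add: cong_def)

lemma cong_sym: "f \<approx> g \<Longrightarrow> g \<approx> f"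
  using nc.subspace_neg[OF subspace_I, of "f - g"] by (simp add: cong_def)

lemma cong_trans [trans]: "f \<approx> g \<Longrightarrow> g \<approx> h \<Longrightarrow> f \<approx> h"
  using nc.subspace_add[OF subspace_I, of "f - g" "g - h"] by (simp add: cong_def)

lemma cong_diff: "f \<approx> g \<Longrightarrow> f' \<approx> g' \<Longrightarrow> f - f' \<approx> g - g'"
  using nc.subspace_diff[OF subspace_I, of "f - g" "f' - g'"]
  by (simp add: cong_def algebra_simps)

lemma cong_mult_left: "h \<in> F \<Longrightarrow> f \<approx> g \<Longrightarrow> h * f \<approx> h * g"
  using mult_I_left[of h "f - g"] by (simp add: cong_def algebra_simps)

lemma cong_mult_right: "h \<in> F \<Longrightarrow> f \<approx> g \<Longrightarrow> f * h \<approx> g * h"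
  using mult_I_right[of h "f - g"] by (simp add: cong_def algebra_simps)

lemma cong_0_iff: "f \<approx> 0 \<longleftrightarrow> f \<in> I"
  by (simp add: cong_def)

lemma cong_in_subspace: "nc.subspace W \<Longrightarrow> I \<subseteq> W \<Longrightarrow> f \<approx> g \<Longrightarrow> g \<in> W \<Longrightarrow> f \<in> W"
  using nc.subspace_add[of W "f - g" g] by (auto simp: cong_def)

lemma comm_cong: "f * g \<approx> h \<Longrightarrow> g * f \<approx> h' \<Longrightarrow> comm f g \<approx> h - h'"
  unfolding comm_def by (rule cong_diff)

lemma cong_0_mult_left: "h \<in> F \<Longrightarrow> f \<approx> 0 \<Longrightarrow> h * f \<approx> 0"
  and cong_0_mult_right: "h \<in> F \<Longrightarrow> f \<approx> 0 \<Longrightarrow> f * h \<approx> 0"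
  by (simp_all add: cong_0_iff mult_I_left mult_I_right)

text \<open>Commutators of elements of \<open>F\<close> with elements of \<open>I\<close> fall into
  \<open>I\<close>, so bilinearity leaves only the generators in \<open>D\<close> to be
  checked.\<close>

lemma comm_span_I:
  assumes W: "nc.subspace W" "I \<subseteq> W" and "D \<subseteq> F"
    and D: "\<And>x y. x \<in> D \<Longrightarrow> y \<in> D \<Longrightarrow> comm x y \<in> W"
    and "f \<in> nc.span (D \<union> I)" "g \<in> nc.span (D \<union> I)"
  shows "comm f g \<in> W"
proof (rule comm_span[OF W(1) _ assms(5,6)])
  show "comm x y \<in> W" if "x \<in> D \<union> I" "y \<in> D \<union> I" for x y
    using that \<open>D \<subseteq> F\<close> W(2) I_subset_F comm_I D by blast
qed

lemma span_Un_I_subset_F: "D \<subseteq> F \<Longrightarrow> nc.span (D \<union> I) \<subseteq> F"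
  using I_subset_F by (intro nc.span_minimal subspace_F) auto

lemma I_subset_span: "I \<subseteq> nc.span (D \<union> I)"
  by (auto intro: nc.span_base)

section \<open>Cosets and the operations of the quotient\<close>

lemma mem_coset: "h \<in> coset f \<longleftrightarrow> h \<approx> f"
  by (force simp: alg_coset_def free_alg_def cong_def image_iff)

lemma coset_eq_iff: "coset f = coset g \<longleftrightarrow> f \<approx> g"
proof
  assume "coset f = coset g"
  then show "f \<approx> g"
    using mem_coset[of f f] mem_coset[of f g] by simp
next
  assume "f \<approx> g"
  then show "coset f = coset g"
    by (simp add: set_eq_iff mem_coset) (meson cong_trans cong_sym)
qed

text \<open>The operations of \<open>alg_quotient\<close> are unions over all representatives. Such
  a union is a single coset once all representatives give congruent results.\<close>

lemma UN_coset: "S \<noteq> {} \<Longrightarrow> (\<And>x. x \<in> S \<Longrightarrow> h x \<approx> g) \<Longrightarrow> (\<Union>x\<in>S. coset (h x)) = coset g"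
proof -
  assume S: "S \<noteq> {}" and h: "\<And>x. x \<in> S \<Longrightarrow> h x \<approx> g"
  have "(\<Union>x\<in>S. coset (h x)) = (\<Union>x\<in>S. coset g)"
    using h by (intro SUP_cong refl) (simp only: coset_eq_iff)
  also have "\<dots> = coset g"
    using S by simp
  finally show ?thesis .
qed

lemma coset_nonempty: "coset f \<noteq> {}"
  using mem_coset[of f f] by auto

lemma mem_coset_F: "h \<in> coset f \<Longrightarrow> f \<in> F \<Longrightarrow> h \<in> F"
  using cong_in_subspace[OF subspace_F I_subset_F] by (simp add: mem_coset)

lemma quotient_add: "alg_add L (coset f) (coset g) = coset (f + g)"
proof -
  have "f' + g' \<approx> f + g" if "f' \<approx> f" "g' \<approx> g" for f' g'
    using nc.subspace_add[OF subspace_I, of "f' - f" "g' - g"] that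
    by (simp add: cong_def algebra_simps)
  then have "(\<Union>y\<in>coset g. coset (x + y)) = coset (f + g)" if "x \<in> coset f" for x
    using that by (intro UN_coset) (auto simp: mem_coset coset_nonempty)
  then show ?thesis
    using coset_nonempty[of f] by (simp add: alg_quotient_def free_alg_def)
qed

lemma quotient_smult: "alg_smult L c (coset f) = coset (const c * f)"
proof -
  have "const c * f' \<approx> const c * f" if "f' \<approx> f" for f'
    using nc.subspace_scale[OF subspace_I, of "f' - f"] that
    by (simp add: cong_def algebra_simps)
  then have "(\<Union>x\<in>coset f. coset (const c * x)) = coset (const c * f)"
    by (intro UN_coset) (auto simp: mem_coset coset_nonempty)
  then show ?thesis
    by (simp add: alg_quotient_def free_alg_def)
qed

lemma quotient_mult:
  assumes "f \<in> F" "g \<in> F"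
  shows "alg_mult L (coset f) (coset g) = coset (f * g)"
proof -
  have "f' * g' \<approx> f * g" if "f' \<in> coset f" "g' \<in> coset g" for f' g'
    using cong_mult_left[of f' g' g] cong_mult_right[of g f' f] cong_trans that
      mem_coset_F[of f' f] assms mem_coset by blast
  then have "(\<Union>y\<in>coset g. coset (x * y)) = coset (f * g)" if "x \<in> coset f" for x
    using that by (intro UN_coset) (auto simp: coset_nonempty)
  then show ?thesis
    using coset_nonempty[of f] by (simp add: alg_quotient_def free_alg_def)
qed

section \<open>The Lie algebra of the quotient and upper bounds for its derived series\<close>

lemma lie_carrier: "alg_carrier (lie_of L) = coset ` F"
  and lie_zero: "alg_zero (lie_of L) = coset 0"
  by (simp_all add: lie_of_def alg_quotient_def) (simp add: free_alg_def)

lemma lie_add: "alg_add (lie_of L) (coset f) (coset g) = coset (f + g)"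
  and lie_smult: "alg_smult (lie_of L) c (coset f) = coset (const c * f)"
  by (simp_all add: lie_of_def quotient_add quotient_smult)

lemma lie_mult:
  "f \<in> F \<Longrightarrow> g \<in> F \<Longrightarrow> alg_mult (lie_of L) (coset f) (coset g) = coset (comm f g)"
  by (simp add: lie_of_def quotient_add quotient_smult quotient_mult comm_def const_minus_one_mult)

lemma subspace_coset: "nc.subspace W \<Longrightarrow> W \<subseteq> F \<Longrightarrow> alg_subspace (lie_of L) (coset ` W)"
  unfolding alg_subspace_def lie_carrier lie_zero
  by (intro conjI ballI allI)
    (auto simp: lie_add lie_smult nc.subspace_0 nc.subspace_add nc.subspace_scale simp del: image_iff intro!: imageI)

text \<open>A derived term is the least subspace containing the brackets of the previous term, so it
  stays inside any subspace that contains them. The bounds \<open>W i\<close> are chosen in the free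
  algebra, where commutators are easy to compute.\<close>

lemma derived_series_subset:
  assumes W: "\<And>i. nc.subspace (W i)" "\<And>i. W i \<subseteq> F" "W 0 = F"
    and comm: "\<And>i f g. f \<in> W i \<Longrightarrow> g \<in> W i \<Longrightarrow> comm f g \<in> W (Suc i)"
  shows "derived_series (lie_of L) i \<subseteq> coset ` W i"
proof (induction i)
  case 0
  then show ?case by (simp add: W lie_carrier)
next
  case (Suc i)
  have "alg_mult (lie_of L) (coset f) (coset g) \<in> coset ` W (Suc i)" if "f \<in> W i" "g \<in> W i" for f g
    using that W(2)[of i] comm[OF that] by (simp add: lie_mult subset_iff)
  then have "{alg_mult (lie_of L) x y |x y. x \<in> derived_series (lie_of L) i \<and> y \<in> derived_series (lie_of L) i}
      \<subseteq> coset ` W (Suc i)"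
    using Suc by blast
  then show ?case
    using alg_span_minimal[OF subspace_coset[OF W(1,2)]] by simp
qed

lemma lie_solvableI:
  assumes W: "\<And>i. nc.subspace (W i)" "\<And>i. W i \<subseteq> F" "W 0 = F"
    and comm: "\<And>i f g. f \<in> W i \<Longrightarrow> g \<in> W i \<Longrightarrow> comm f g \<in> W (Suc i)"
    and "W n \<subseteq> I"
  shows "lie_solvable L"
proof -
  have "coset ` W n \<subseteq> {coset 0}"
    using \<open>W n \<subseteq> I\<close> unfolding image_subset_iff singleton_iff coset_eq_iff cong_0_iff by blast
  with derived_series_subset[of W n, OF W comm] have "derived_series (lie_of L) n \<subseteq> {coset 0}"
    by blast
  \<comment> \<open>Solvability asks for equality with the zero space, so zero has to be exhibited
    in the term as well.\<close>
  moreover have "coset 0 \<in> derived_series (lie_of L) n"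
    using nc.subspace_0[OF subspace_F]
    by (cases n) (simp_all add: lie_carrier alg_span_def alg_subspace_def lie_zero)
  ultimately have "derived_series (lie_of L) n = {alg_zero (lie_of L)}"
    by (auto simp: lie_zero)
  then show ?thesis
    by (auto simp: lie_solvable_def solvable_lie_def)
qed

end

section \<open>Matrix units\<close>

context quotient_alg
begin

text \<open>Elements of \<open>I\<close> have coset zero, so adding them to the generators leaves
  the image unchanged and accounts for the kernel of \<open>coset\<close>.\<close>

lemma lie_span:
  assumes "U \<subseteq> F"
  shows "alg_span (lie_of L) (coset ` U) = coset ` nc.span (U \<union> I)"
proof
  have "nc.span (U \<union> I) \<subseteq> F"
    by (rule span_Un_I_subset_F[OF assms])
  then show "alg_span (lie_of L) (coset ` U) \<subseteq> coset ` nc.span (U \<union> I)"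
    by (intro alg_span_minimal subspace_coset nc.subspace_span) (auto intro: nc.span_base)
  have "coset f \<in> T"
    if T: "alg_subspace (lie_of L) T" "coset ` U \<subseteq> T" and f: "f \<in> nc.span (U \<union> I)" for T f
    using f
  proof (induction f rule: nc.span_induct_alt)
    case base
    then show ?case using T by (simp add: alg_subspace_def lie_zero)
  next
    case (step c x f)
    have "coset x \<in> T"
    proof (cases "x \<in> U")
      case False
      then have "coset x = coset 0"
        using step by (auto simp only: coset_eq_iff cong_0_iff Un_iff)
      then show ?thesis using T by (simp add: alg_subspace_def lie_zero)
    qed (use T in auto)
    then have "alg_add (lie_of L) (alg_smult (lie_of L) c (coset x)) (coset f) \<in> T"
      using T step.IH by (simp add: alg_subspace_def)
    then show ?case by (simp only: lie_add lie_smult)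
  qed
  then show "coset ` nc.span (U \<union> I) \<subseteq> alg_span (lie_of L) (coset ` U)"
    unfolding alg_span_def by blast
qed

text \<open>The units span a finite-dimensional Lie subalgebra of the quotient. Its off-diagonal
  units are again obtained from commutators, so they survive in every derived term, while
  \<open>u 0 1\<close> is nonzero.\<close>

lemma matrix_units_not_locally_lie_solvable:
  fixes u :: "nat \<Rightarrow> nat \<Rightarrow> ('g, 'k) ncpoly"
  assumes uF: "\<And>i j. i < n \<Longrightarrow> j < n \<Longrightarrow> u i j \<in> F"
    and mult: "\<And>i j k l. i < n \<Longrightarrow> j < n \<Longrightarrow> k < n \<Longrightarrow> l < n \<Longrightarrow>
      u i j * u k l \<approx> (if j = k then u i l else 0)"
    and nonzero: "u 0 1 \<notin> I"
    and n: "n \<ge> 3 \<or> n = 2 \<and> (2 :: 'k) \<noteq> 0"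
  shows "\<not> locally_lie_solvable L"
proof
  assume *: "locally_lie_solvable L"
  define U where "U = {u i j | i j. i < n \<and> j < n}"
  define S where "S = nc.span (U \<union> I)"
  have UF: "U \<subseteq> F"
    using uF by (auto simp: U_def)
  have SF: "S \<subseteq> F"
    unfolding S_def by (rule span_Un_I_subset_F[OF UF])
  have subS: "nc.subspace S"
    by (simp add: S_def)
  have IS: "I \<subseteq> S"
    unfolding S_def by (rule I_subset_span)
  have uS: "u i j \<in> S" if "i < n" "j < n" for i j
    using that by (auto simp: S_def U_def intro!: nc.span_base)
  have comm_u: "comm (u i j) (u k l) \<approx> (if j = k then u i l else 0) - (if l = i then u k j else 0)"
    if "i < n" "j < n" "k < n" "l < n" for i j k l
    using that by (intro comm_cong mult)
  have comm_S: "comm f g \<in> S" if "f \<in> S" "g \<in> S" for f g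
  proof (rule comm_span_I[OF subS IS UF _ that[unfolded S_def]])
    fix x y assume "x \<in> U" "y \<in> U"
    then obtain i j k l where "x = u i j" "y = u k l" "i < n" "j < n" "k < n" "l < n"
      by (auto simp: U_def)
    then show "comm x y \<in> S"
      using cong_in_subspace[OF subS IS comm_u] uS
      by (simp add: nc.subspace_diff[OF subS] nc.subspace_0[OF subS] nc.subspace_neg[OF subS])
  qed
  let ?M = "(lie_of L)\<lparr>alg_carrier := coset ` S\<rparr>"
  have "finite (coset ` U)"
    by (simp add: U_def finite_image_set2)
  then have "alg_finite_dim (lie_of L) (coset ` S)"
    unfolding alg_finite_dim_def
    by (metis S_def UF Un_upper1 alg_span_superset lie_span)
  moreover have "alg_subalgebra (lie_of L) (coset ` S)"
    unfolding alg_subalgebra_def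
  proof (rule conjI, rule subspace_coset[OF subS SF], safe)
    fix f g assume fg: "f \<in> S" "g \<in> S"
    then have "alg_mult (lie_of L) (coset f) (coset g) = coset (comm f g)"
      using SF by (intro lie_mult) auto
    then show "alg_mult (lie_of L) (coset f) (coset g) \<in> coset ` S"
      using comm_S[OF fg] by simp
  qed
  ultimately obtain N where N: "derived_series ?M N = {alg_zero (lie_of L)}"
    using * by (auto simp: locally_lie_solvable_def locally_solvable_lie_def solvable_lie_def)
  have step: "coset h \<in> derived_series ?M (Suc m)"
    if "coset f \<in> derived_series ?M m" "coset g \<in> derived_series ?M m" "comm f g \<approx> h"
      "f \<in> F" "g \<in> F" for f g h m
  proof -
    have "alg_mult ?M (coset f) (coset g) = coset h"
      using that coset_eq_iff lie_mult by simp
    then show ?thesis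
      using that alg_span_superset by fastforce
  qed
  \<comment> \<open>The differences of diagonal units are carried along for the case
    \<open>n = 2\<close>, where no third index is available and the argument is that sl_2 is perfect
    outside characteristic 2.\<close>
  have "coset (u i j) \<in> derived_series ?M m \<and>
      ((2 :: 'k) \<noteq> 0 \<longrightarrow> coset (u i i - u j j) \<in> derived_series ?M m)"
    if "i < n" "j < n" "i \<noteq> j" for i j m
    using that
  proof (induction m arbitrary: i j)
    case 0
    then show ?case
      using uS nc.subspace_diff[OF subS] by auto
  next
    case (Suc m)
    note IH = Suc.IH[THEN conjunct1] Suc.IH[THEN conjunct2, rule_format]
    have "coset (u i j) \<in> derived_series ?M (Suc m)"
    proof (cases "n \<ge> 3")
      case True
      \<comment> \<open>With a third index \<open>k\<close>, the unit \<open>u i j\<close> is the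
        commutator of the off-diagonal units \<open>u i k\<close> and \<open>u k j\<close>.\<close>
      have "card ({..<n} - {i, j}) > 0"
        using True Suc.prems by (simp add: card_Diff_subset)
      then obtain k where k: "k < n" "k \<noteq> i" "k \<noteq> j"
        by (metis Diff_iff card_gt_0_iff ex_in_conv insertCI lessThan_iff)
      have "comm (u i k) (u k j) \<approx> u i j"
        using comm_u[of i k k j] k Suc.prems by simp
      then show ?thesis
        using Suc.prems k uF by (intro step[of "u i k" m "u k j"] IH) auto
    next
      case False
      then have 2: "(2 :: 'k) \<noteq> 0"
        using n by simp
      have "comm (u i i) (u i j) \<approx> u i j" "comm (u j j) (u i j) \<approx> - u i j"
        using comm_u[of i i i j] comm_u[of j j i j] Suc.prems by simp_all
      then have "comm (u i i) (u i j) - comm (u j j) (u i j) \<approx> u i j - (- u i j)"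
        by (rule cong_diff)
      \<comment> \<open>The root vector \<open>u i j\<close> has weight 2, and 2 is invertible
        here.\<close>
      then have "comm (u i i - u j j) (u i j) \<approx> const 2 * u i j"
        by (simp add: comm_def algebra_simps mult_2)
      then have "coset (const 2 * u i j) \<in> derived_series ?M (Suc m)"
        using Suc.prems uF 2
        by (intro step[of "u i i - u j j" m "u i j"] IH) (auto intro: nc.subspace_diff[OF subspace_F])
      then have "alg_smult ?M (inverse 2) (coset (const 2 * u i j)) \<in> derived_series ?M (Suc m)"
        using alg_span_smult by fastforce
      moreover have "const (inverse 2) * (const 2 * u i j) = u i j"
        using 2 by (simp add: mult_single flip: mult.assoc del: single_numeral)
      ultimately show ?thesis
        by (simp add: lie_smult)
    qed
    moreover have "coset (u i i - u j j) \<in> derived_series ?M (Suc m)"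
      using comm_u[of i j j i] Suc.prems uF by (intro step[of "u i j" m "u j i"] IH) auto
    ultimately show ?case by blast
  qed
  from this[of 0 1 N] have "coset (u 0 1) = coset 0"
    using n N by (auto simp: lie_zero)
  then show False
    using nonzero by (simp only: coset_eq_iff cong_0_iff)
qed

text \<open>Modulo \<open>I\<close>, the products \<open>p i * q j\<close> are matrix units.\<close>

lemma dual_system_not_locally_lie_solvable:
  fixes n :: nat
  assumes F: "\<And>i. i < n \<Longrightarrow> p i \<in> F" "\<And>i. i < n \<Longrightarrow> q i \<in> F" "v \<in> F"
    and qp: "\<And>i j. i < n \<Longrightarrow> j < n \<Longrightarrow> q i * p j \<approx> (if i = j then v else 0)"
    and pv: "\<And>i. i < n \<Longrightarrow> p i * v \<approx> p i"
    and v: "v * v \<approx> v" "v \<notin> I"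
    and n: "n \<ge> 3 \<or> n = 2 \<and> (2 :: 'k) \<noteq> 0"
  shows "\<not> locally_lie_solvable L"
proof (rule matrix_units_not_locally_lie_solvable[of n "\<lambda>i j. p i * q j"])
  fix i j k l assume i: "i < n" "j < n" "k < n" "l < n"
  have "p i * (q j * p k) * q l \<approx> p i * (if j = k then v else 0) * q l"
    using i by (intro cong_mult_left cong_mult_right qp F)
  also have "\<dots> \<approx> (if j = k then p i * q l else 0)"
    using i pv[of i] by (auto intro: cong_mult_right F)
  finally show "p i * q j * (p k * q l) \<approx> (if j = k then p i * q l else 0)"
    by (simp add: mult.assoc)
next
  have n': "0 < n" "1 < n"
    using n by auto
  \<comment> \<open>Multiplying \<open>p 0 * q 1\<close> by \<open>q 0\<close> on the left and
    \<open>p 1\<close> on the right gives \<open>v\<close>, which is not in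
    \<open>I\<close>.\<close>
  have "q 0 * p 0 * (q 1 * p 1) \<approx> v * (q 1 * p 1)"
    using qp[of 0 0] n' F by (intro cong_mult_right mult_F) auto
  also have "\<dots> \<approx> v * v"
    using qp[of 1 1] n' F by (intro cong_mult_left) auto
  also have "\<dots> \<approx> v" by (fact v)
  finally have eq: "q 0 * (p 0 * q 1) * p 1 \<approx> v"
    by (simp add: mult.assoc)
  show "p 0 * q 1 \<notin> I"
  proof
    assume "p 0 * q 1 \<in> I"
    then have "q 0 * (p 0 * q 1) * p 1 \<in> I"
      using n' F by (intro mult_I_right[OF _ mult_I_left]) auto
    then show False
      using v(2) eq cong_sym cong_trans cong_0_iff by blast
  qed
qed (use n F mult_F in auto)

end

section \<open>Vertices do not vanish\<close>

text \<open>The extension of operators \<open>T x\<close> from variables to polynomials: a word acts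
  by composing the operators of its letters, the last letter acting first.\<close>

definition act :: "('g \<Rightarrow> ('x \<Rightarrow> 'k) \<Rightarrow> 'x \<Rightarrow> 'k) \<Rightarrow> ('g, 'k::field) ncpoly \<Rightarrow> ('x \<Rightarrow> 'k) \<Rightarrow> 'x \<Rightarrow> 'k" where
  "act T f h z = (\<Sum>w\<in>Poly_Mapping.keys f. Poly_Mapping.lookup f w * foldr T (letters w) h z)"

lemma act_single: "act T (Poly_Mapping.single w c) h z = c * foldr T (letters w) h z"
  by (simp add: act_def)

lemma act_ncvar: "act T (ncvar x) h = T x h"
  by (simp add: fun_eq_iff ncvar_def act_single)

lemma act_zero: "act T 0 h z = 0"
  by (simp add: act_def)

lemma act_add: "act T (f + g) h z = act T f h z + act T g h z"
proof -
  let ?A = "Poly_Mapping.keys f \<union> Poly_Mapping.keys g"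
  have *: "act T f' h z = (\<Sum>w\<in>?A. Poly_Mapping.lookup f' w * foldr T (letters w) h z)"
    if "Poly_Mapping.keys f' \<subseteq> ?A" for f'
    unfolding act_def using that by (intro sum.mono_neutral_left) (auto simp: in_keys_iff)
  show ?thesis
    using keys_add[of f g] by (simp add: * lookup_add distrib_right sum.distrib)
qed

lemma act_diff: "act T (f - g) h z = act T f h z - act T g h z"
  using act_add[of T "f - g" g h z] by simp

lemma act_sum: "act T (\<Sum>i\<in>A. f i) h z = (\<Sum>i\<in>A. act T (f i) h z)"
  by (induction A rule: infinite_finite_induct) (simp_all add: act_zero act_add)

locale linear_action =
  fixes T :: "'g \<Rightarrow> ('x \<Rightarrow> 'k::field) \<Rightarrow> 'x \<Rightarrow> 'k"
  assumes linear: "T x (\<lambda>z. c * h z + h' z) = (\<lambda>z. c * T x h z + T x h' z)"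
begin

lemma foldr_linear: "foldr T xs (\<lambda>z. c * h z + h' z) = (\<lambda>z. c * foldr T xs h z + foldr T xs h' z)"
  by (induction xs) (simp_all add: linear)

lemma foldr_zero: "foldr T xs (\<lambda>z. 0) = (\<lambda>z. 0)"
  \<comment> \<open>With scalar -1 and both functions zero, linearity says that the image of zero is
    minus itself plus itself.\<close>
  using foldr_linear[of xs "-1" "\<lambda>_. 0" "\<lambda>_. 0"] by simp

text \<open>Concatenation of words is composition of operators; expanding both factors into
  monomials does the rest. Thus \<open>act T\<close> is a representation.\<close>

lemma act_mult: "act T (f * g) h z = act T f (act T g h) z"
proof (induction f arbitrary: z rule: ncpoly_induct)
  case (single w c)
  have "foldr T (letters w) (act T g h) z = act T (Poly_Mapping.single w 1 * g) h z" for z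
  proof (induction g arbitrary: z rule: ncpoly_induct)
    case zero
    then show ?case by (simp add: act_zero[abs_def] foldr_zero)
  next
    case (single w' c')
    then show ?case
      using foldr_linear[of "letters w" c' "foldr T (letters w') h" "\<lambda>_. 0"]
      by (simp add: act_single[abs_def] mult_single plus_free_monoid_def foldr_zero)
  next
    case (add f g)
    then show ?case
      using foldr_linear[of "letters w" 1 "act T f h" "act T g h"]
      by (simp add: act_add[abs_def] distrib_left)
  qed
  moreover have "act T (Poly_Mapping.single w c * g) h z = c * act T (Poly_Mapping.single w 1 * g) h z"
  proof (induction g rule: ncpoly_induct)
    case (single w' c')
    then show ?case by (simp add: act_single mult_single mult.assoc)
  qed (simp_all add: act_zero act_add distrib_left)
  ultimately show ?case by (simp add: act_single)
qed (simp_all add: act_zero act_add distrib_right)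

lemma act_zero_right: "act T f (\<lambda>z. 0) = (\<lambda>z. 0)"
  by (simp add: act_def[abs_def] foldr_zero)

text \<open>The kernel of a representation is an ideal, so it contains the ideal generated by any
  relations that act as zero.\<close>

lemma ideal_act_kernel:
  "alg_ideal (free_alg X) {f \<in> alg_carrier (free_alg X). \<forall>h. act T f h = (\<lambda>z. 0)}"
proof -
  have "act T (const c * f) h z = c * act T f h z" for c f h z
    by (simp add: act_mult act_single zero_free_monoid_def)
  then show ?thesis
    unfolding alg_ideal_free_alg_iff nc.subspace_def
    using subspace_free_alg[of X, unfolded nc.subspace_def]
    by (auto simp: mult_free_alg act_mult[abs_def] act_zero[abs_def] act_add[abs_def] act_zero_right)
qed

end

section \<open>A representation of the Leavitt path algebra on functions\<close>

text \<open>
  The set \<open>nat + 'e\<close> is infinite and at least as large as any set of arcs, so it is in bijection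
  with \<open>out_arcs E v \<times> (nat + 'e)\<close> for every vertex \<open>v\<close> that is not a sink.
\<close>

lemma ex_branching_maps:
  "\<exists>g :: 'e \<Rightarrow> nat + 'e \<Rightarrow> nat + 'e. \<forall>v. out_arcs E v \<noteq> {} \<longrightarrow>
     bij_betw (\<lambda>(e, x). g e x) (out_arcs E v \<times> UNIV) UNIV"
proof -
  let ?X = "UNIV :: (nat + 'e) set"
  have "\<exists>\<phi>. bij_betw \<phi> (out_arcs E v \<times> ?X) ?X" if "out_arcs E v \<noteq> {}" for v
  proof -
    have "(card_of (out_arcs E v), card_of ?X) \<in> ordLeq"
      by (rule card_of_ordLeqI[of Inr]) auto
    with that have "(card_of (out_arcs E v \<times> ?X), card_of ?X) \<in> ordIso"
      by (intro card_of_Times_infinite[THEN conjunct2]) auto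
    then show ?thesis by (simp add: card_of_ordIso)
  qed
  then obtain \<phi> where \<phi>: "bij_betw (\<phi> v) (out_arcs E v \<times> ?X) ?X" if "out_arcs E v \<noteq> {}" for v
    by metis
  \<comment> \<open>Each arc has exactly one source, so the bijections chosen at the separate
    vertices glue to one family indexed by arcs.\<close>
  have "bij_betw (\<lambda>(e, x). \<phi> (tail E e) (e, x)) (out_arcs E v \<times> ?X) ?X" if "out_arcs E v \<noteq> {}" for v
    using \<phi>[OF that] by (subst bij_betw_cong[of _ _ "\<phi> v"]) auto
  then show ?thesis
    by (intro exI[of _ "\<lambda>e x. \<phi> (tail E e) (e, x)"]) blast
qed

text \<open>The representation of a branching system. A vertex projects onto the functions over it;
  \<open>Edge e\<close> transports values over \<open>head E e\<close> along \<open>g e\<close> to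
  the range of \<open>g e\<close> over \<open>tail E e\<close>; \<open>Ghost e\<close> pulls them
  back.\<close>

fun lpa_act :: "('v, 'e) pre_digraph \<Rightarrow> ('e \<Rightarrow> 'x \<Rightarrow> 'x) \<Rightarrow> ('v, 'e) lpa_gen \<Rightarrow>
    ('v \<times> 'x \<Rightarrow> 'k::field) \<Rightarrow> 'v \<times> 'x \<Rightarrow> 'k" where
  "lpa_act E g (Vertex v) h (w, x) = (if w = v then h (w, x) else 0)"
| "lpa_act E g (Edge e) h (w, x) =
     (if w = tail E e \<and> x \<in> range (g e) then h (head E e, inv (g e) x) else 0)"
| "lpa_act E g (Ghost e) h (w, x) = (if w = head E e then h (tail E e, g e x) else 0)"

text \<open>All relations act as zero, hence so does the ideal they generate, whereas
  \<open>Vertex v\<close> preserves the value 1 of the constant function over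
  \<open>v\<close>.\<close>

lemma vertex_not_in_lpa_ideal:
  fixes E :: "('v, 'e) pre_digraph"
  assumes "lpa_rels E \<subseteq> alg_carrier (free_alg (lpa_gens E) :: ('k::field, _) alg)"
  shows "(ncvar (Vertex v) :: (_, 'k) ncpoly) \<notin> alg_ideal_gen (free_alg (lpa_gens E)) (lpa_rels E)"
proof -
  obtain g :: "'e \<Rightarrow> nat + 'e \<Rightarrow> nat + 'e"
    where g: "out_arcs E v \<noteq> {} \<Longrightarrow> bij_betw (\<lambda>(e, x). g e x) (out_arcs E v \<times> UNIV) UNIV" for v
    using ex_branching_maps[of E] by blast
  let ?T = "lpa_act E g :: _ \<Rightarrow> (_ \<Rightarrow> 'k) \<Rightarrow> _"
  interpret linear_action ?T
  proof
    show "?T x (\<lambda>z. c * h z + h' z) = (\<lambda>z. c * ?T x h z + ?T x h' z)" for x c h h'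
      by (cases x) (auto simp: fun_eq_iff)
  qed
  have g_eq: "g e x = g f y \<longleftrightarrow> e = f \<and> x = y"
    if "e \<in> arcs E" "f \<in> arcs E" "tail E e = tail E f" for e f x y
  proof -
    have "inj_on (\<lambda>(e, x). g e x) (out_arcs E (tail E e) \<times> UNIV)"
      using that by (intro bij_betw_imp_inj_on[OF g]) (force simp: set_eq_iff)
    from inj_on_eq_iff[OF this, of "(e, x)" "(f, y)"] show ?thesis
      using that by simp
  qed
  have inv_g: "inv (g e) (g e x) = x" if "e \<in> arcs E" for e x
    using g_eq[OF that that] by (intro inv_f_f injI) auto
  have g_ex: "\<exists>!e. e \<in> out_arcs E v \<and> x \<in> range (g e)" if v: "out_arcs E v \<noteq> {}" for v x
  proof -
    have "x \<in> (\<lambda>(e, x). g e x) ` (out_arcs E v \<times> UNIV)"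
      using g[OF v] by (simp add: bij_betw_def)
    then obtain e y where "e \<in> out_arcs E v" "x = g e y" by auto
    moreover have "f = e" if f: "f \<in> out_arcs E v \<and> x \<in> range (g f)" for f
    proof -
      from f obtain y' where "x = g f y'" by auto
      then show ?thesis
        using f calculation g_eq[of f e y' y] by simp
    qed
    ultimately show ?thesis by blast
  qed
  \<comment> \<open>The ranges of \<open>g e\<close> for the arcs \<open>e\<close> leaving
    \<open>v\<close> partition the points, so exactly one summand contributes at
    \<open>x\<close>.\<close>
  have sum: "act ?T (\<Sum>e\<in>out_arcs E v. ncvar (Edge e) * ncvar (Ghost e)) h (w, x) =
      (if w = v then h (w, x) else 0)" if v: "v \<in> regular_verts E" for v w x h
  proof -
    have "out_arcs E v \<noteq> {}" and fin: "finite (out_arcs E v)"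
      using v by (auto simp: regular_verts_def)
    from g_ex[OF this(1), of x] obtain e where e: "e \<in> out_arcs E v" "x \<in> range (g e)"
      and uniq: "\<And>f. f \<in> out_arcs E v \<Longrightarrow> x \<in> range (g f) \<Longrightarrow> f = e" by blast
    let ?s = "\<lambda>e. if w = tail E e \<and> x \<in> range (g e) then h (tail E e, g e (inv (g e) x)) else 0"
    have "act ?T (ncvar (Edge e) * ncvar (Ghost e)) h (w, x) = ?s e" for e
      by (simp add: act_mult act_ncvar)
    then have "act ?T (\<Sum>e\<in>out_arcs E v. ncvar (Edge e) * ncvar (Ghost e)) h (w, x) = sum ?s (out_arcs E v)"
      by (simp only: act_sum)
    also have "\<dots> = sum ?s {e}"
    proof (rule sum.mono_neutral_right)
      show "\<forall>f\<in>out_arcs E v - {e}. ?s f = 0"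
        using uniq by (intro ballI if_not_P) blast
    qed (use fin e in simp_all)
    also have "\<dots> = (if w = v then h (w, x) else 0)"
      using e by (simp add: f_inv_into_f)
    finally show ?thesis .
  qed
  let ?J = "{f \<in> alg_carrier (free_alg (lpa_gens E)). \<forall>h. act ?T f h = (\<lambda>z. 0)}"
  have "act ?T r h z = 0" if "r \<in> lpa_rels E" for r h z
  proof (cases z)
    case (Pair w x)
    show ?thesis
      using that unfolding lpa_rels_def Pair
      by (elim UnE CollectE exE conjE)
        (auto simp: act_diff act_mult act_ncvar act_zero inv_g g_eq sum)
  qed
  then have "alg_ideal_gen (free_alg (lpa_gens E)) (lpa_rels E) \<subseteq> ?J"
    using assms by (intro alg_ideal_gen_minimal ideal_act_kernel) auto
  moreover have "act ?T (ncvar (Vertex v)) (\<lambda>_. 1) (v, undefined) \<noteq> 0"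
    by (simp add: act_ncvar)
  ultimately show ?thesis
    by (auto simp: fun_eq_iff)
qed

section \<open>Obstructions to local solvability\<close>

lemma lpa_rels_subset:
  assumes "wf_digraph E"
  shows "lpa_rels E \<subseteq> (alg_carrier (free_alg (lpa_gens E)) :: (_, 'k::field) ncpoly set)"
proof -
  let ?F = "alg_carrier (free_alg (lpa_gens E)) :: (_, 'k) ncpoly set"
  interpret wf_digraph E by fact
  have F: "v \<in> verts E \<Longrightarrow> ncvar (Vertex v) \<in> ?F"
    "e \<in> arcs E \<Longrightarrow> ncvar (Edge e) \<in> ?F" "e \<in> arcs E \<Longrightarrow> ncvar (Ghost e) \<in> ?F" for v e
    by (auto intro!: ncvar_free_alg simp: lpa_gens_def)
  note sub = subspace_free_alg[of "lpa_gens E", where ?'k = 'k]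
  have S: "(\<Sum>e\<in>out_arcs E v. ncvar (Edge e) * ncvar (Ghost e)) \<in> ?F" for v
    using F by (intro nc.subspace_sum[OF sub] mult_free_alg) auto
  show ?thesis
    unfolding lpa_rels_def
    by (auto intro!: nc.subspace_diff[OF sub] mult_free_alg F S nc.subspace_0[OF sub]
        simp: regular_verts_def)
qed

section \<open>The defining relations as congruences, and their first consequences\<close>

locale lpa = wf_digraph E for E :: "('v, 'e) pre_digraph" +
  fixes I :: "(('v, 'e) lpa_gen, 'k::field) ncpoly set"
  assumes I_eq: "I = alg_ideal_gen (free_alg (lpa_gens E)) (lpa_rels E)"
begin

sublocale quotient_alg "lpa_gens E" I
  unfolding I_eq by (intro quotient_alg.intro alg_ideal_gen_free_alg lpa_rels_subset) unfold_locales

abbreviation V :: "'v \<Rightarrow> (('v, 'e) lpa_gen, 'k) ncpoly" where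
  "V v \<equiv> ncvar (Vertex v)"

abbreviation A :: "'e \<Rightarrow> (('v, 'e) lpa_gen, 'k) ncpoly" where
  "A e \<equiv> ncvar (Edge e)"

abbreviation G :: "'e \<Rightarrow> (('v, 'e) lpa_gen, 'k) ncpoly" where
  "G e \<equiv> ncvar (Ghost e)"

lemma gens_F [simp]:
  "v \<in> verts E \<Longrightarrow> V v \<in> F" "e \<in> arcs E \<Longrightarrow> A e \<in> F" "e \<in> arcs E \<Longrightarrow> G e \<in> F"
  by (auto intro!: ncvar_free_alg simp: lpa_gens_def)

lemma V_not_in_I: "V v \<notin> I"
  unfolding I_eq by (intro vertex_not_in_lpa_ideal lpa_rels_subset) unfold_locales

lemma rel_cong: "f - g \<in> lpa_rels E \<Longrightarrow> f \<approx> g"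
  using alg_ideal_gen_superset[of "lpa_rels E"] unfolding cong_def unfolding I_eq by blast

lemma V_V: "v \<in> verts E \<Longrightarrow> w \<in> verts E \<Longrightarrow> V v * V w \<approx> (if v = w then V v else 0)"
  by (rule rel_cong) (unfold lpa_rels_def, blast)

lemma tail_A: "e \<in> arcs E \<Longrightarrow> V (tail E e) * A e \<approx> A e"
  by (rule rel_cong) (unfold lpa_rels_def, blast)

lemma A_head: "e \<in> arcs E \<Longrightarrow> A e * V (head E e) \<approx> A e"
  by (rule rel_cong) (unfold lpa_rels_def, blast)

lemma head_G: "e \<in> arcs E \<Longrightarrow> V (head E e) * G e \<approx> G e"
  by (rule rel_cong) (unfold lpa_rels_def, blast)

lemma G_tail: "e \<in> arcs E \<Longrightarrow> G e * V (tail E e) \<approx> G e"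
  by (rule rel_cong) (unfold lpa_rels_def, blast)

lemma G_A: "e \<in> arcs E \<Longrightarrow> f \<in> arcs E \<Longrightarrow> G e * A f \<approx> (if e = f then V (head E e) else 0)"
  by (rule rel_cong) (unfold lpa_rels_def, blast)

text \<open>Two distinct, hence orthogonal, vertices can be inserted between the factors.\<close>

lemma mult_cong_0:
  assumes "f * V v \<approx> f" "V w * g \<approx> g" "v \<noteq> w" "v \<in> verts E" "w \<in> verts E" "f \<in> F" "g \<in> F"
  shows "f * g \<approx> 0"
proof -
  have "f * g \<approx> f * V v * g"
    using assms by (intro cong_mult_right cong_sym[OF assms(1)])
  also have "\<dots> \<approx> f * V v * (V w * g)"
    using assms by (intro cong_mult_left cong_sym[OF assms(2)] mult_F gens_F)
  also have "\<dots> = f * (V v * V w * g)"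
    by (simp add: mult.assoc)
  also have "\<dots> \<approx> 0"
    using V_V[of v w] assms by (simp add: cong_0_mult_left cong_0_mult_right)
  finally show ?thesis .
qed

lemma V_A: "v \<in> verts E \<Longrightarrow> e \<in> arcs E \<Longrightarrow> V v * A e \<approx> (if v = tail E e then A e else 0)"
  using tail_A[of e] V_V[of v v] by (auto intro!: mult_cong_0[of _ v "tail E e"])

lemma A_V: "v \<in> verts E \<Longrightarrow> e \<in> arcs E \<Longrightarrow> A e * V v \<approx> (if v = head E e then A e else 0)"
  using A_head[of e] V_V[of v v] by (auto intro!: mult_cong_0[of _ "head E e" v])

lemma V_G: "v \<in> verts E \<Longrightarrow> e \<in> arcs E \<Longrightarrow> V v * G e \<approx> (if v = head E e then G e else 0)"
  using head_G[of e] V_V[of v v] by (auto intro!: mult_cong_0[of _ v "head E e"])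

lemma G_V: "v \<in> verts E \<Longrightarrow> e \<in> arcs E \<Longrightarrow> G e * V v \<approx> (if v = tail E e then G e else 0)"
  using G_tail[of e] V_V[of v v] by (auto intro!: mult_cong_0[of _ "tail E e" v])

lemma A_A: "e \<in> arcs E \<Longrightarrow> f \<in> arcs E \<Longrightarrow> head E e \<noteq> tail E f \<Longrightarrow> A e * A f \<approx> 0"
  by (intro mult_cong_0[OF A_head tail_A]) auto

lemma A_G: "e \<in> arcs E \<Longrightarrow> f \<in> arcs E \<Longrightarrow> head E e \<noteq> head E f \<Longrightarrow> A e * G f \<approx> 0"
  by (intro mult_cong_0[OF A_head head_G]) auto

lemma G_G: "e \<in> arcs E \<Longrightarrow> f \<in> arcs E \<Longrightarrow> tail E e \<noteq> head E f \<Longrightarrow> G e * G f \<approx> 0"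
  by (intro mult_cong_0[OF G_tail head_G]) auto

text \<open>The vertex \<open>head E e\<close> and the arc \<open>e\<close> are two distinct paths
  with the same range; their duals are the vertex itself and \<open>G e\<close>.\<close>

lemma not_solvable_if_arc_char_not_2:
  assumes e: "e \<in> arcs E" "head E e \<noteq> tail E e" and "(2 :: 'k) \<noteq> 0"
  shows "\<not> locally_lie_solvable L"
proof -
  let ?v = "head E e"
  show ?thesis
  proof (rule dual_system_not_locally_lie_solvable[of 2 "\<lambda>i. [V ?v, A e] ! i" "\<lambda>i. [V ?v, G e] ! i" "V ?v"])
    show "[V ?v, G e] ! i * [V ?v, A e] ! j \<approx> (if i = j then V ?v else 0)" if "i < 2" "j < 2" for i j
      using that V_V[of ?v ?v] V_A[of ?v e] G_V[of ?v e] G_A[of e e] e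
      by (auto simp: less_2_cases_iff)
    show "[V ?v, A e] ! i * V ?v \<approx> [V ?v, A e] ! i" if "i < 2" for i
      using that V_V[of ?v ?v] A_head[of e] e by (auto simp: less_2_cases_iff)
  qed (use assms V_V[of ?v ?v] V_not_in_I in \<open>auto simp: less_2_cases_iff\<close>)
qed

lemma less_3_cases_iff: "n < 3 \<longleftrightarrow> n = 0 \<or> n = 1 \<or> n = (2 :: nat)"
  by auto

text \<open>The three paths ending at \<open>head E f\<close> are this vertex, \<open>f\<close>, and
  \<open>e\<close> followed by \<open>f\<close>.\<close>

lemma not_solvable_if_path:
  assumes e: "e \<in> arcs E" "f \<in> arcs E" "head E e = tail E f"
    and acyclic: "head E e \<noteq> tail E e" "head E f \<noteq> tail E f" "head E f \<noteq> tail E e"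
  shows "\<not> locally_lie_solvable L"
proof -
  let ?v = "head E f"
  let ?p = "[V ?v, A f, A e * A f]" and ?q = "[V ?v, G f, G f * G e]"
  have "e \<noteq> f"
    using e acyclic by auto
  have v: "?v \<in> verts E"
    using e by simp
  \<comment> \<open>In each of these four mixed products two adjacent factors already multiply to
    zero, by acyclicity or by \<open>e \<noteq> f\<close>.\<close>
  have 1: "V ?v * (A e * A f) \<approx> 0"
    using V_A[of ?v e] acyclic e by (simp flip: mult.assoc add: cong_0_mult_right)
  have 2: "G f * (A e * A f) \<approx> 0"
    using G_A[of f e] \<open>e \<noteq> f\<close> e by (simp flip: mult.assoc add: cong_0_mult_right)
  have 3: "G f * G e * V ?v \<approx> 0"
    using G_V[of ?v e] acyclic e by (simp add: mult.assoc cong_0_mult_left)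
  have 4: "G f * G e * A f \<approx> 0"
    using G_A[of e f] \<open>e \<noteq> f\<close> e by (simp add: mult.assoc cong_0_mult_left)
  have "G f * (G e * A e) * A f \<approx> G f * V (head E e) * A f"
    using G_A[of e e] e by (intro cong_mult_left cong_mult_right) auto
  also have "\<dots> = G f * (V (tail E f) * A f)"
    using e by (simp add: mult.assoc)
  also have "\<dots> \<approx> G f * A f"
    using e tail_A[of f] by (intro cong_mult_left) auto
  also have "\<dots> \<approx> V ?v"
    using e G_A[of f f] by simp
  finally have 5: "G f * G e * (A e * A f) \<approx> V ?v"
    by (simp add: mult.assoc)
  have 6: "A e * A f * V ?v \<approx> A e * A f"
    using cong_mult_left[OF _ A_head, of "A e" f] e by (simp add: mult.assoc)
  show ?thesis
  proof (rule dual_system_not_locally_lie_solvable[of 3 "\<lambda>i. ?p ! i" "\<lambda>i. ?q ! i" "V ?v"])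
    show "?q ! i * ?p ! j \<approx> (if i = j then V ?v else 0)" if "i < 3" "j < 3" for i j
      using that V_V[of ?v ?v] V_A[of ?v f] G_V[of ?v f] G_A[of f f] e v acyclic 1 2 3 4 5
      by (auto simp: less_3_cases_iff)
    show "?p ! i * V ?v \<approx> ?p ! i" if "i < 3" for i
      using that V_V[of ?v ?v] A_head[of f] e v 6 by (auto simp: less_3_cases_iff)
  qed (use e v V_V[of ?v ?v] V_not_in_I in \<open>auto simp: less_3_cases_iff intro!: mult_F\<close>)
qed

text \<open>Here the three paths with the same range are the vertex and the two arcs.\<close>

lemma not_solvable_if_common_head:
  assumes e: "e \<in> arcs E" "f \<in> arcs E" "head E e = head E f" "e \<noteq> f"
    and acyclic: "head E e \<noteq> tail E e" "head E f \<noteq> tail E f"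
  shows "\<not> locally_lie_solvable L"
proof -
  let ?v = "head E e"
  let ?p = "[V ?v, A e, A f]" and ?q = "[V ?v, G e, G f]"
  have v: "?v \<in> verts E"
    using e by simp
  show ?thesis
  proof (rule dual_system_not_locally_lie_solvable[of 3 "\<lambda>i. ?p ! i" "\<lambda>i. ?q ! i" "V ?v"])
    show "?q ! i * ?p ! j \<approx> (if i = j then V ?v else 0)" if "i < 3" "j < 3" for i j
      using that V_V[of ?v ?v] V_A[of ?v f] V_A[of ?v e] G_V[of ?v f] G_V[of ?v e]
        G_A[of f f] G_A[of e e] G_A[of e f] G_A[of f e] e v acyclic
      by (auto simp: less_3_cases_iff)
    show "?p ! i * V ?v \<approx> ?p ! i" if "i < 3" for i
      using that V_V[of ?v ?v] A_head[of f] A_head[of e] e v by (auto simp: less_3_cases_iff)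
  qed (use e v V_V[of ?v ?v] V_not_in_I in \<open>auto simp: less_3_cases_iff\<close>)
qed

end

section \<open>Stars\<close>

datatype ('v, 'e) nform = NV 'v | NE 'e | NG 'e | NP 'e

text \<open>The first two conditions say that every component is an isolated vertex or a star: no
  vertex both receives and emits arcs, and none receives more than one.\<close>

locale star_lpa = lpa E I for E :: "('v, 'e) pre_digraph" and I :: "(('v, 'e) lpa_gen, 'k::field) ncpoly set" +
  assumes no_path: "e \<in> arcs E \<Longrightarrow> f \<in> arcs E \<Longrightarrow> head E e \<noteq> tail E f"
    and head_inj: "inj_on (head E) (arcs E)"
    and char: "arcs E \<noteq> {} \<Longrightarrow> (2 :: 'k) = 0"
begin

section \<open>Multiplication of the spanning elements\<close>

fun val :: "('v, 'e) nform \<Rightarrow> (('v, 'e) lpa_gen, 'k) ncpoly" where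
  "val (NV v) = V v"
| "val (NE e) = A e"
| "val (NG e) = G e"
| "val (NP e) = A e * G e"

text \<open>The default value 0 covers the products that would need a path of length 2. For
  \<open>NE e\<close> and \<open>NG f\<close> with \<open>e \<noteq> f\<close> the product vanishes
  because the heads differ.\<close>

fun mult_table :: "('v, 'e) nform \<Rightarrow> ('v, 'e) nform \<Rightarrow> (('v, 'e) lpa_gen, 'k) ncpoly" where
  "mult_table (NV v) (NV w) = (if v = w then V v else 0)"
| "mult_table (NV v) (NE e) = (if v = tail E e then A e else 0)"
| "mult_table (NV v) (NG e) = (if v = head E e then G e else 0)"
| "mult_table (NV v) (NP e) = (if v = tail E e then A e * G e else 0)"
| "mult_table (NE e) (NV v) = (if v = head E e then A e else 0)"
| "mult_table (NE e) (NG f) = (if e = f then A e * G e else 0)"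
| "mult_table (NG e) (NV v) = (if v = tail E e then G e else 0)"
| "mult_table (NG e) (NE f) = (if e = f then V (head E e) else 0)"
| "mult_table (NG e) (NP f) = (if e = f then G e else 0)"
| "mult_table (NP e) (NV v) = (if v = tail E e then A e * G e else 0)"
| "mult_table (NP e) (NE f) = (if e = f then A e else 0)"
| "mult_table (NP e) (NP f) = (if e = f then A e * G e else 0)"
| "mult_table _ _ = 0"

text \<open>These elements span modulo \<open>I\<close> but may be dependent: a regular vertex is
  congruent to the sum of \<open>A e * G e\<close> over its arcs.\<close>

definition basis :: "('v, 'e) nform set" where
  "basis = NV ` verts E \<union> NE ` arcs E \<union> NG ` arcs E \<union> NP ` arcs E"

lemma val_F: "b \<in> basis \<Longrightarrow> val b \<in> F"
  by (auto simp: basis_def intro!: mult_F)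

lemma mult_val_NP:
  assumes x: "x \<in> F" and e: "e \<in> arcs E" and y: "x * A e \<approx> y"
  shows "x * val (NP e) \<approx> y * G e"
  using cong_mult_right[OF _ y, of "G e"] e by (simp add: mult.assoc)

lemma val_NP_mult:
  assumes x: "x \<in> F" and e: "e \<in> arcs E" and y: "G e * x \<approx> y"
  shows "val (NP e) * x \<approx> A e * y"
  using cong_mult_left[OF _ y, of "A e"] e by (simp add: mult.assoc)

lemma val_mult_val:
  assumes "a \<in> basis" "b \<in> basis"
  shows "val a * val b \<approx> mult_table a b"
proof -
  note [simp] = no_path no_path[symmetric]
  have AA: "A e * A f \<approx> 0" if "e \<in> arcs E" "f \<in> arcs E" for e f
    using that by (intro A_A) auto
  have GG: "G e * G f \<approx> 0" if "e \<in> arcs E" "f \<in> arcs E" for e f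
    using that by (intro G_G) auto
  have AG: "A e * G f \<approx> (if e = f then A e * G e else 0)" if "e \<in> arcs E" "f \<in> arcs E" for e f
    using that A_G[of e f] inj_on_eq_iff[OF head_inj] by auto
  have VP: "V v * val (NP e) \<approx> mult_table (NV v) (NP e)" if "v \<in> verts E" "e \<in> arcs E" for v e
    using mult_val_NP[OF _ _ V_A[of v e]] that by (auto split: if_splits)
  have PV: "val (NP e) * V v \<approx> mult_table (NP e) (NV v)" if "v \<in> verts E" "e \<in> arcs E" for v e
    using val_NP_mult[OF _ _ G_V[of v e]] that by (auto split: if_splits)
  have AP: "A e * val (NP f) \<approx> 0" if "e \<in> arcs E" "f \<in> arcs E" for e f
    using mult_val_NP[OF _ _ AA[of e f]] that by auto
  have PG: "val (NP e) * G f \<approx> 0" if "e \<in> arcs E" "f \<in> arcs E" for e f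
    using val_NP_mult[OF _ _ GG[of e f]] that by auto
  have GP: "G e * val (NP f) \<approx> (if e = f then G e else 0)" if "e \<in> arcs E" "f \<in> arcs E" for e f
    using mult_val_NP[OF _ _ G_A[of e f]] that cong_trans[OF _ head_G[of e]] by (auto split: if_splits)
  have PA: "val (NP e) * A f \<approx> (if e = f then A e else 0)" if "e \<in> arcs E" "f \<in> arcs E" for e f
    using val_NP_mult[OF _ _ G_A[of e f]] that cong_trans[OF _ A_head[of e]] by (auto split: if_splits)
  have PP: "val (NP e) * val (NP f) \<approx> (if e = f then A e * G e else 0)" if "e \<in> arcs E" "f \<in> arcs E" for e f
    using mult_val_NP[OF _ _ PA[of e f]] mult_F[of "A e" "G e"] that by (auto split: if_splits)
  show ?thesis
    using assms unfolding basis_def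
    by (elim UnE imageE; hypsubst)
      (use V_V V_A A_V V_G G_V G_A AA GG AG VP PV AP PG GP PA PP
        in \<open>simp_all del: val.simps(4) if_split add: val.simps(1-3)\<close>)
qed

lemma comm_val: "a \<in> basis \<Longrightarrow> b \<in> basis \<Longrightarrow> comm (val a) (val b) \<approx> mult_table a b - mult_table b a"
  by (intro comm_cong val_mult_val)

lemma mult_table_in_span: "a \<in> basis \<Longrightarrow> b \<in> basis \<Longrightarrow> mult_table a b \<in> nc.span (val ` basis \<union> I)"
proof -
  have "V v \<in> nc.span (val ` basis \<union> I)" if "v \<in> verts E" for v
    using that by (intro nc.span_base UnI1 image_eqI[of _ _ "NV v"]) (auto simp: basis_def)
  moreover have "A e \<in> nc.span (val ` basis \<union> I)" if "e \<in> arcs E" for e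
    using that by (intro nc.span_base UnI1 image_eqI[of _ _ "NE e"]) (auto simp: basis_def)
  moreover have "G e \<in> nc.span (val ` basis \<union> I)" if "e \<in> arcs E" for e
    using that by (intro nc.span_base UnI1 image_eqI[of _ _ "NG e"]) (auto simp: basis_def)
  moreover have "A e * G e \<in> nc.span (val ` basis \<union> I)" if "e \<in> arcs E" for e
    using that by (intro nc.span_base UnI1 image_eqI[of _ _ "NP e"]) (auto simp: basis_def)
  ultimately show "mult_table a b \<in> nc.span (val ` basis \<union> I)" if "a \<in> basis" "b \<in> basis"
    using that by (cases a; cases b) (auto simp: basis_def nc.span_zero)
qed

text \<open>The span contains the generators and, by the multiplication table, is stable under left
  multiplication by them; so it contains every nonempty word.\<close>

lemma F_subset_span_basis: "F \<subseteq> nc.span (val ` basis \<union> I)" (is "_ \<subseteq> ?S")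
proof
  note IS = I_subset_span[of "val ` basis"]
  have gen: "\<exists>b\<in>basis. val b = ncvar x" if "x \<in> lpa_gens E" for x
    using that unfolding lpa_gens_def basis_def by (auto simp: bex_Un)
  have mult: "val b * f \<in> ?S" if b: "b \<in> basis" and f: "f \<in> ?S" for b f
    using f
  proof (induction f rule: nc.span_induct_alt)
    case base
    then show ?case by (simp add: nc.span_zero)
  next
    case (step c x f)
    have "val b * x \<in> ?S"
    proof (cases "x \<in> I")
      case True
      then show ?thesis
        using b IS by (meson mult_I_left subsetD val_F)
    next
      case False
      then obtain a where "a \<in> basis" "x = val a"
        using step by auto
      then show ?thesis
        using b cong_in_subspace[OF nc.subspace_span IS val_mult_val] mult_table_in_span by blast
    qed
    then show ?case
      using step by (simp add: distrib_left mult_const_left_commute nc.span_add nc.span_scale)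
  qed
  have word: "Poly_Mapping.single (Word xs) 1 \<in> ?S" if "xs \<noteq> []" "set xs \<subseteq> lpa_gens E" for xs
    using that
  proof (induction xs rule: list_nonempty_induct)
    case (single x)
    then obtain b where "b \<in> basis" "val b = ncvar x"
      using gen by auto
    then show ?case
      by (metis (no_types) UnI1 image_eqI nc.span_base ncvar_def)
  next
    case (cons x xs)
    then obtain b where "b \<in> basis" "val b = ncvar x"
      using gen by auto
    moreover have "Poly_Mapping.single (Word (x # xs)) 1 = ncvar x * Poly_Mapping.single (Word xs) 1"
      by (simp add: ncvar_def mult_single plus_free_monoid_def)
    ultimately show ?case
      using cons mult by (metis insert_subset list.simps(15))
  qed
  fix f :: "(('v, 'e) lpa_gen, 'k) ncpoly" assume f: "f \<in> F"
  show "f \<in> ?S"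
  proof (induction f rule: ncpoly_induct)
    case (single w c)
    then have "Poly_Mapping.single (Word (letters w)) 1 \<in> ?S"
      using f by (intro word) (auto simp: free_alg_def)
    from nc.span_scale[OF this, of c] show ?case
      by (simp add: mult_single)
  qed (auto intro: nc.span_zero nc.span_add)
qed

section \<open>Commutators and the derived series\<close>

abbreviation Z :: "'e \<Rightarrow> (('v, 'e) lpa_gen, 'k) ncpoly" where
  "Z e \<equiv> A e * G e - V (head E e)"

definition derived_gens :: "(('v, 'e) lpa_gen, 'k) ncpoly set" where
  "derived_gens = A ` arcs E \<union> G ` arcs E \<union> Z ` arcs E"

lemma Z_F: "e \<in> arcs E \<Longrightarrow> Z e \<in> F"
  by (intro nc.subspace_diff[OF subspace_F] mult_F) auto

lemma derived_gens_subset_F: "derived_gens \<subseteq> F"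
  using Z_F by (auto simp: derived_gens_def)

text \<open>Vertices and the elements \<open>A e * G e\<close> commute with each other. Every other
  bracket is, up to sign, zero, an arc, a ghost arc, or \<open>Z e\<close> as the bracket of
  \<open>A e\<close> and \<open>G e\<close>.\<close>

lemma comm_basis:
  assumes "a \<in> basis" "b \<in> basis"
  shows "comm (val a) (val b) \<in> nc.span (derived_gens \<union> I)" (is "_ \<in> ?S")
proof (rule cong_in_subspace[OF nc.subspace_span I_subset_span comm_val[OF assms]])
  have A: "A e \<in> ?S" and G: "G e \<in> ?S" and Z: "Z e \<in> ?S" if "e \<in> arcs E" for e
    using that by (auto intro!: nc.span_base simp: derived_gens_def)
  have "V (head E e) - A e * G e \<in> ?S" if "e \<in> arcs E" for e
    using nc.span_neg[OF Z[OF that]] by simp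
  then show "mult_table a b - mult_table b a \<in> ?S"
    using assms A G Z
    by (cases a; cases b) (auto simp: basis_def nc.span_zero intro: nc.span_neg)
qed

lemma comm_Z:
  assumes "e \<in> arcs E" "b \<in> basis"
  shows "comm (Z e) (val b) \<approx>
    mult_table (NP e) b - mult_table b (NP e) -
    (mult_table (NV (head E e)) b - mult_table b (NV (head E e)))"
proof -
  have "comm (Z e) (val b) = comm (val (NP e)) (val b) - comm (val (NV (head E e))) (val b)"
    by (simp add: comm_def algebra_simps)
  then show ?thesis
    using assms by (simp only:) (intro cong_diff comm_val, auto simp: basis_def)
qed

lemma double_eq_0:
  assumes "e \<in> arcs E"
  shows "f + f = (0 :: (('v, 'e) lpa_gen, 'k) ncpoly)"
proof -
  have "f + f = const 2 * f"
    by (simp add: mult_2)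
  also have "\<dots> = 0"
    using assms char by (metis empty_iff mult_zero_left single_zero)
  finally show ?thesis .
qed

text \<open>For \<open>e = f\<close> the bracket is \<open>A e + A e\<close>, which is where
  characteristic 2 enters: there \<open>Z e\<close> is the identity of the block of 2 by 2 matrix
  units belonging to \<open>e\<close>. For \<open>e \<noteq> f\<close> all products vanish.\<close>

lemma comm_Z_A: "e \<in> arcs E \<Longrightarrow> f \<in> arcs E \<Longrightarrow> comm (Z e) (A f) \<approx> 0"
  using comm_Z[of e "NE f"] no_path[of e f] double_eq_0[of e "A e"] inj_on_eq_iff[OF head_inj, of e f]
  by (auto simp: basis_def)

lemma comm_Z_G: "e \<in> arcs E \<Longrightarrow> f \<in> arcs E \<Longrightarrow> comm (Z e) (G f) \<approx> 0"
  using comm_Z[of e "NG f"] no_path[of e f] double_eq_0[of e "- G e"] inj_on_eq_iff[OF head_inj, of e f]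
  by (auto simp: basis_def)

lemma comm_Z_Z: "e \<in> arcs E \<Longrightarrow> f \<in> arcs E \<Longrightarrow> comm (Z e) (Z f) \<approx> 0"
proof -
  assume ef: "e \<in> arcs E" "f \<in> arcs E"
  have "comm (Z e) (val (NP f)) - comm (Z e) (val (NV (head E f))) \<approx> 0 - 0"
    using comm_Z[of e "NP f"] comm_Z[of e "NV (head E f)"] no_path[of e f] no_path[of f e] ef
    by (intro cong_diff) (auto simp: basis_def split: if_splits)
  then show ?thesis
    by (simp add: comm_def algebra_simps)
qed

lemma comm_swap_0: "comm f g \<approx> 0 \<Longrightarrow> comm g f \<approx> 0"
  using nc.subspace_neg[OF subspace_I, of "comm f g"] by (simp add: cong_0_iff comm_def)

text \<open>The only brackets that need not vanish modulo \<open>I\<close> are those of an arc with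
  its own ghost, and they give \<open>Z e\<close> up to sign.\<close>

lemma comm_derived_gens:
  assumes "x \<in> derived_gens" "y \<in> derived_gens"
  shows "comm x y \<in> nc.span (Z ` arcs E \<union> I)" (is "_ \<in> ?S")
proof -
  note sub = cong_in_subspace[OF nc.subspace_span I_subset_span]
  have Z: "Z e \<in> ?S" if "e \<in> arcs E" for e
    using that by (auto intro: nc.span_base)
  have 0: "comm f g \<in> ?S" if "comm f g \<approx> 0" for f g
    using that by (rule sub) (rule nc.span_zero)
  have AA: "comm (A e) (A f) \<in> ?S" "comm (G e) (G f) \<in> ?S" if "e \<in> arcs E" "f \<in> arcs E" for e f
    using comm_val[of "NE e" "NE f"] comm_val[of "NG e" "NG f"] that by (auto simp: basis_def intro: 0)
  have AG: "comm (A e) (G f) \<in> ?S" if "e \<in> arcs E" "f \<in> arcs E" for e f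
    using comm_val[of "NE e" "NG f"] that by (cases "e = f") (auto simp: basis_def intro: 0 sub[OF _ Z])
  have GA: "comm (G e) (A f) \<in> ?S" if "e \<in> arcs E" "f \<in> arcs E" for e f
    using nc.span_neg[OF AG[OF that(2,1)]] by (simp add: comm_def)
  show ?thesis
    using assms unfolding derived_gens_def
    by (elim UnE imageE; hypsubst)
      (rule AA AG GA 0[OF comm_Z_A] 0[OF comm_Z_G] 0[OF comm_swap_0[OF comm_Z_A]]
        0[OF comm_swap_0[OF comm_Z_G]] 0[OF comm_Z_Z]; assumption)+
qed

text \<open>The bounds for the derived series have index 0 to 3; continuing with \<open>I\<close>
  beyond that defines them for every index.\<close>

lemma star_lie_solvable: "lie_solvable L"
proof (rule lie_solvableI[of "\<lambda>i. if i = 0 then F else if i = 1 then nc.span (derived_gens \<union> I)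
    else if i = 2 then nc.span (Z ` arcs E \<union> I) else I" 3])
  fix i f g
  let ?W = "\<lambda>i :: nat. if i = 0 then F else if i = 1 then nc.span (derived_gens \<union> I)
    else if i = 2 then nc.span (Z ` arcs E \<union> I) else I"
  have ZF: "Z ` arcs E \<subseteq> F"
    using Z_F by auto
  show "nc.subspace (?W i)"
    by (simp add: subspace_F subspace_I)
  show "?W i \<subseteq> F"
    using I_subset_F span_Un_I_subset_F[OF derived_gens_subset_F] span_Un_I_subset_F[OF ZF] by simp
  assume fg: "f \<in> ?W i" "g \<in> ?W i"
  consider "i = 0" | "i = 1" | "i = 2" | "i > 2"
    by linarith
  then show "comm f g \<in> ?W (Suc i)"
  proof cases
    case 1
    then have "f \<in> nc.span (val ` basis \<union> I)" "g \<in> nc.span (val ` basis \<union> I)"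
      using fg F_subset_span_basis by auto
    then have "comm f g \<in> nc.span (derived_gens \<union> I)"
      by (rule comm_span_I[rotated 4]) (use I_subset_span comm_basis val_F in auto)
    then show ?thesis using 1 by simp
  next
    case 2
    then have "f \<in> nc.span (derived_gens \<union> I)" "g \<in> nc.span (derived_gens \<union> I)"
      using fg by simp_all
    then have "comm f g \<in> nc.span (Z ` arcs E \<union> I)"
      by (rule comm_span_I[OF nc.subspace_span I_subset_span derived_gens_subset_F, rotated]) (rule comm_derived_gens)
    then show ?thesis using 2 by simp
  next
    case 3
    then have "f \<in> nc.span (Z ` arcs E \<union> I)" "g \<in> nc.span (Z ` arcs E \<union> I)"
      using fg by simp_all
    moreover have "comm x y \<in> I" if "x \<in> Z ` arcs E" "y \<in> Z ` arcs E" for x y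
      using that comm_Z_Z cong_0_iff by blast
    ultimately have "comm f g \<in> I"
      using comm_span_I[OF subspace_I order_refl ZF] by blast
    then show ?thesis using 3 by simp
  next
    case 4
    then show ?thesis using fg comm_I I_subset_F by auto
  qed
qed auto

end

section \<open>Reduction of an acyclic graph to a union of stars\<close>

theorem theorem4p8:
  fixes E :: "('v, 'e) pre_digraph"
  assumes "wf_digraph E"
    and "acyclic_digraph E"
    and "locally_lie_solvable (leavitt_path_algebra E :: ('v, 'e, 'k::field) lpa)"
  shows "lie_solvable (leavitt_path_algebra E :: ('v, 'e, 'k) lpa)"
proof -
  interpret wf_digraph E by fact
  define I where "I = (alg_ideal_gen (free_alg (lpa_gens E)) (lpa_rels E) :: (('v, 'e) lpa_gen, 'k) ncpoly set)"
  interpret lpa E I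
    by unfold_locales (rule I_def)
  have L: "leavitt_path_algebra E = L"
    by (simp add: leavitt_path_algebra_def I_def)
  have loc: "locally_lie_solvable L"
    using assms(3) by (simp only: L)
  have no_loop: "head E e \<noteq> tail E e" if "e \<in> arcs E" for e
  proof
    assume "head E e = tail E e"
    then have "awalk (tail E e) [e] (tail E e)"
      using that by (simp add: awalk_def)
    then show False
      using assms(2) by (auto simp: acyclic_digraph_def)
  qed
  have no_2_cycle: "head E f \<noteq> tail E e" if "e \<in> arcs E" "f \<in> arcs E" "head E e = tail E f" for e f
  proof
    assume "head E f = tail E e"
    then have "awalk (tail E e) [e, f] (tail E e)"
      using that by (simp add: awalk_def)
    then show False
      using assms(2) by (auto simp: acyclic_digraph_def)
  qed
  \<comment> \<open>Each condition on a star is the contrapositive of one obstruction; the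
    inequalities these ask for exclude closed walks of length 1 and 2.\<close>
  interpret star_lpa E I
  proof
    show "head E e \<noteq> tail E f" if "e \<in> arcs E" "f \<in> arcs E" for e f
      using not_solvable_if_path[OF that] that no_loop no_2_cycle loc by blast
    show "inj_on (head E) (arcs E)"
      using not_solvable_if_common_head no_loop loc by (meson inj_onI)
    show "(2 :: 'k) = 0" if "arcs E \<noteq> {}"
      using not_solvable_if_arc_char_not_2 no_loop loc that by blast
  qed
  show ?thesis
    using star_lie_solvable by (simp only: L)
qed

end
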